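(* There is a constant $\delta>0.058$ such that for every $N$ there is a partition of the edges of the complete bipartite graph $K_{N,N}$ into two graphs $G_1$ and $G_2$ such that, for each $i\in\{1,2\}$, the edges of $G_i$ can be covered by at most $O(N^{2-\delta})$ induced matchings of $G_i$ (the implied constant being absolute).
   Context: $K_{N,N}$ is the complete bipartite graph with $N$ vertices on each side. An induced matching in a graph $G$ is a set of pairwise vertex-disjoint edges of $G$ such that the subgraph of $G$ induced on the set of endpoints of these edges contains no other edges; here "induced" is with respect to the individual graph $G_i$. *)

theory Defs
  imports Complex_Main
begin

text \<open>A simple graph is represented by its edge set, an edge being the two-element set of its
  endpoints. Isolated vertices play no role for edge partitions and induced matchings.\<close>

definition complete_bipartite :: "nat \<Rightarrow> (nat + nat) set set" where
  "complete_bipartite N = {{Inl i, Inr j} | i j. i < N \<and> j < N}"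

text \<open>The last conjunct says that the subgraph of \<open>G\<close> induced on the endpoints \<open>\<Union>M\<close> has no
  edges besides those of \<open>M\<close>.\<close>

definition induced_matching :: "'v set set \<Rightarrow> 'v set set \<Rightarrow> bool" where
  "induced_matching G M \<longleftrightarrow>
     M \<subseteq> G \<and>
     (\<forall>e\<in>M. \<forall>f\<in>M. e \<noteq> f \<longrightarrow> e \<inter> f = {}) \<and>
     {e \<in> G. e \<subseteq> \<Union>M} \<subseteq> M"

end

theory Submission
  imports Defs
begin

text \<open>Encode the vertices of each side by subsets of a set \<open>A\<close> with \<open>2m + 1\<close> elements, and put
  \<open>xy\<close> into \<open>G\<^sub>1\<close> iff \<open>card (x \<triangle> y) > m\<close>, where \<open>x \<triangle> y\<close> is the symmetric difference. Complementing \<open>y\<close>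
  turns \<open>G\<^sub>2\<close> into a graph of the same kind. Fix \<open>z\<close> with \<open>card z > m\<close> and consider the edges with
  \<open>x \<triangle> y = z\<close> whose left ends \<open>x\<close> agree outside \<open>z\<close>. Two left ends \<open>x \<noteq> x'\<close> satisfy
  \<open>card (x \<triangle> y') = card z - card (x \<triangle> x')\<close>, so such edges form an induced matching as soon as their
  left ends are pairwise at distance at least \<open>card z - m\<close>. A greedy colouring splits
  \<open>Pow z\<close> into \<open>4 ^ card z / 3 ^ m\<close> codes of that distance, and altogether this uses at most
  \<open>(\<Sum>z. 2 ^ (2m + 1 - card z) * 4 ^ card z) / 3 ^ m = 6 * 12 ^ m\<close> induced matchings. As
  \<open>12 < 4 powr 1.8\<close>, any \<open>\<delta> \<le> 0.2\<close> is admissible.\<close>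

section \<open>Greedy colouring and codes in a power set\<close>

text \<open>Vertices are coloured one at a time: the neighbours of a new vertex number fewer than
  \<open>q\<close>, so some colour below \<open>q\<close> is free for it.\<close>

lemma greedy_colouring:
  assumes "finite V"
    and "\<And>u v. R u v \<Longrightarrow> R v u"
    and "\<And>v. v \<in> V \<Longrightarrow> card {u \<in> V. u \<noteq> v \<and> R u v} < q"
  shows "\<exists>c :: 'a \<Rightarrow> nat. (\<forall>v\<in>V. c v < q) \<and> (\<forall>u\<in>V. \<forall>v\<in>V. u \<noteq> v \<longrightarrow> c u = c v \<longrightarrow> \<not> R u v)"
  using assms(1,3)
proof (induction V rule: finite_induct)
  case empty
  then show ?case by simp
next
  case (insert w V)
  have "card {u \<in> V. u \<noteq> v \<and> R u v} < q" if "v \<in> V" for v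
    using insert.prems[of v] that
      card_mono[of "{u \<in> insert w V. u \<noteq> v \<and> R u v}" "{u \<in> V. u \<noteq> v \<and> R u v}"] insert.hyps
    by fastforce
  then obtain c :: "'a \<Rightarrow> nat" where c: "\<forall>v\<in>V. c v < q"
    "\<forall>u\<in>V. \<forall>v\<in>V. u \<noteq> v \<longrightarrow> c u = c v \<longrightarrow> \<not> R u v"
    using insert.IH by blast
  let ?U = "{u \<in> V. R u w}"
  have "{u \<in> insert w V. u \<noteq> w \<and> R u w} = ?U"
    using insert.hyps by auto
  then have "card (c ` ?U) < card {..<q}"
    using insert.prems[of w] card_image_le[of ?U c] insert.hyps by simp
  then have "\<not> {..<q} \<subseteq> c ` ?U"
    using card_mono[of "c ` ?U" "{..<q}"] insert.hyps(1) by fastforce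
  then obtain k where k: "k < q" "k \<notin> c ` ?U"
    by blast
  have "c v \<noteq> k" if "v \<in> V" "R v w \<or> R w v" for v
    using k(2) that assms(2) by blast
  then show ?case
    using c k(1) insert.hyps(2) by (intro exI[of _ "c(w := k)"]) auto
qed

lemma sum_Pow_power:
  fixes a b :: "'a :: comm_semiring_1"
  assumes "finite A"
  shows "(\<Sum>z\<in>Pow A. a ^ card z * b ^ card (A - z)) = (a + b) ^ card A"
  using prod_add[OF assms, of "\<lambda>_. a" "\<lambda>_. b"] by simp

text \<open>Give each subset \<open>l\<close> of \<open>z\<close> the weight
  \<open>3 ^ card (z - l)\<close>. The counted sets have weight at least \<open>3 ^ m\<close>, and
  all weights add up to \<open>(1 + 3) ^ card z\<close>. With a weight base t in place of 3, the
  final count would grow like ((3 + t)^2 / t)^m, which is smallest at t = 3.\<close>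

lemma card_small_subsets_le:
  assumes "finite z"
  shows "card {l. l \<subseteq> z \<and> card l + m < card z} * 3 ^ m \<le> (4::nat) ^ card z"
proof -
  let ?L = "{l. l \<subseteq> z \<and> card l + m < card z}"
  have "card ?L * 3 ^ m = (\<Sum>l\<in>?L. 3 ^ m)"
    by simp
  also have "\<dots> \<le> (\<Sum>l\<in>?L. 3 ^ card (z - l))"
    using assms by (intro sum_mono power_increasing) (auto simp: card_Diff_subset finite_subset)
  also have "\<dots> \<le> (\<Sum>l\<in>Pow z. 3 ^ card (z - l))"
    using assms by (intro sum_mono2) auto
  also have "\<dots> = 4 ^ card z"
    using sum_Pow_power[OF assms, of 1 3] by simp
  finally show ?thesis .
qed

lemma code_partition:
  fixes z :: "'a set"
  assumes "finite z" and "m < card z"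
  shows "\<exists>c :: 'a set \<Rightarrow> nat. (\<forall>a\<in>Pow z. c a < 4 ^ card z div 3 ^ m) \<and>
    (\<forall>a\<in>Pow z. \<forall>b\<in>Pow z. a \<noteq> b \<longrightarrow> c a = c b \<longrightarrow> card z \<le> card (sym_diff a b) + m)"
proof -
  let ?R = "\<lambda>a b :: 'a set. card (sym_diff a b) + m < card z"
  let ?L = "{l. l \<subseteq> z \<and> card l + m < card z}"
  have "card {u \<in> Pow z. u \<noteq> v \<and> ?R u v} < 4 ^ card z div 3 ^ m" if v: "v \<in> Pow z" for v
  proof -
    have fin: "finite ?L"
      using assms(1) by auto
    \<comment> \<open>Neighbours of \<open>v\<close> correspond to their differences from
      \<open>v\<close>. As \<open>u \<noteq> v\<close>, the empty set does not occur, which yields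
      the strict bound that the greedy colouring needs.\<close>
    have "card {u \<in> Pow z. u \<noteq> v \<and> ?R u v} \<le> card (?L - {{}})"
    proof (rule card_inj_on_le)
      show "inj_on (\<lambda>u. sym_diff u v) {u \<in> Pow z. u \<noteq> v \<and> ?R u v}"
        by (rule inj_on_inverseI[where g = "\<lambda>u. sym_diff u v"]) auto
      show "(\<lambda>u. sym_diff u v) ` {u \<in> Pow z. u \<noteq> v \<and> ?R u v} \<subseteq> ?L - {{}}"
      proof (intro image_subsetI)
        fix u assume "u \<in> {u \<in> Pow z. u \<noteq> v \<and> ?R u v}"
        then have "sym_diff u v \<subseteq> z" "sym_diff u v \<noteq> {}" "?R u v"
          using v by blast+
        then show "sym_diff u v \<in> ?L - {{}}"
          by blast
      qed
    qed (use fin in simp)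
    also have "\<dots> < card ?L"
      using fin assms(2) by (intro card_Diff1_less) simp_all
    also have "\<dots> \<le> 4 ^ card z div 3 ^ m"
      using card_small_subsets_le[OF assms(1), of m] by (simp add: less_eq_div_iff_mult_less_eq)
    finally show ?thesis .
  qed
  then have "\<exists>c :: 'a set \<Rightarrow> nat. (\<forall>v\<in>Pow z. c v < 4 ^ card z div 3 ^ m) \<and>
      (\<forall>u\<in>Pow z. \<forall>v\<in>Pow z. u \<noteq> v \<longrightarrow> c u = c v \<longrightarrow> \<not> ?R u v)"
    using assms(1) by (intro greedy_colouring[of "Pow z" ?R]) (simp_all add: Un_commute)
  then show ?thesis
    by (simp add: not_less)
qed

section \<open>Covering a distance graph by induced matchings\<close>

text \<open>The two sides have separate labellings so that one definition serves both graphs of the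
  partition.\<close>

definition distance_graph ::
    "nat \<Rightarrow> nat \<Rightarrow> (nat \<Rightarrow> 'a set) \<Rightarrow> (nat \<Rightarrow> 'a set) \<Rightarrow> (nat + nat) set set" where
  "distance_graph m N f g =
     {{Inl i, Inr j} | i j. i < N \<and> j < N \<and> m < card (sym_diff (f i) (g j))}"

definition shift_class ::
    "nat \<Rightarrow> (nat \<Rightarrow> 'a set) \<Rightarrow> (nat \<Rightarrow> 'a set) \<Rightarrow> ('a set \<Rightarrow> 'a set \<Rightarrow> nat) \<Rightarrow>
      'a set \<times> 'a set \<times> nat \<Rightarrow> (nat + nat) set set" where
  "shift_class N f g col = (\<lambda>(z, c, k). {{Inl i, Inr j} | i j. i < N \<and> j < N \<and>
     sym_diff (f i) (g j) = z \<and> f i - z = c \<and> col z (f i \<inter> z) = k})"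

lemma edge_eq_iff: "{Inl i, Inr j} = {Inl i', Inr j'} \<longleftrightarrow> i = i' \<and> j = j'"
  by (auto simp: doubleton_eq_iff)

text \<open>Given \<open>z\<close>, the label of either end of an edge determines that of the other,
  so injectivity makes the edges disjoint. The code distance excludes further edges between their
  ends.\<close>

lemma induced_matching_shift_class:
  assumes inj: "inj_on f {..<N}" "inj_on g {..<N}"
    and z: "finite z" "m < card z"
    and col: "\<And>a b. a \<subseteq> z \<Longrightarrow> b \<subseteq> z \<Longrightarrow> a \<noteq> b \<Longrightarrow> col z a = col z b \<Longrightarrow>
      card z \<le> card (sym_diff a b) + m"
  shows "induced_matching (distance_graph m N f g) (shift_class N f g col (z, c, k))"
proof -
  let ?P = "\<lambda>i j. i < N \<and> j < N \<and> sym_diff (f i) (g j) = z \<and> f i - z = c \<and> col z (f i \<inter> z) = k"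
  let ?M = "shift_class N f g col (z, c, k)"
  have M: "?M = {{Inl i, Inr j} | i j. ?P i j}"
    by (simp add: shift_class_def)
  have left: "j = j'" if "?P i j" "?P i j'" for i j j'
  proof -
    have "g j = g j'" using that by blast
    then show ?thesis using inj(2) that by (auto dest: inj_onD)
  qed
  have right: "i = i'" if "?P i j" "?P i' j" for i i' j
  proof -
    have "f i = f i'" using that by blast
    then show ?thesis using inj(1) that by (auto dest: inj_onD)
  qed
  have cross: "i = i'" if P: "?P i j" "?P i' j'" and gt: "m < card (sym_diff (f i) (g j'))" for i j i' j'
  proof (rule ccontr)
    assume "i \<noteq> i'"
    then have "f i \<noteq> f i'" using inj(1) P by (auto dest: inj_onD)
    then have "f i \<inter> z \<noteq> f i' \<inter> z" using P by blast
    then have le: "card z \<le> card (sym_diff (f i \<inter> z) (f i' \<inter> z)) + m"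
      using P by (intro col) auto
    let ?D = "sym_diff (f i \<inter> z) (f i' \<inter> z)"
    \<comment> \<open>The label \<open>g j'\<close> is \<open>sym_diff (f i') z\<close>, and
      \<open>f i\<close>, \<open>f i'\<close> differ only inside \<open>z\<close>, namely in
      \<open>?D\<close>.\<close>
    have "sym_diff (f i) (g j') = z - ?D"
      using P by blast
    moreover have "card (z - ?D) = card z - card ?D"
      using z(1) by (intro card_Diff_subset) (auto intro: finite_subset[of _ z])
    ultimately show False using gt le by simp
  qed
  have "?M \<subseteq> distance_graph m N f g"
    unfolding M distance_graph_def using z(2) by blast
  moreover have "e = e'" if "e \<in> ?M" "e' \<in> ?M" and meet: "e \<inter> e' \<noteq> {}" for e e'
  proof -
    obtain i j where e: "e = {Inl i, Inr j}" "?P i j"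
      using \<open>e \<in> ?M\<close> unfolding M by blast
    obtain i' j' where e': "e' = {Inl i', Inr j'}" "?P i' j'"
      using \<open>e' \<in> ?M\<close> unfolding M by blast
    from e e' consider "i = i'" | "j = j'" using meet by auto
    then show ?thesis
    proof cases
      case 1
      with e e' left[of i j j'] show ?thesis by simp
    next
      case 2
      with e e' right[of i j i'] show ?thesis by simp
    qed
  qed
  moreover have "e \<in> ?M" if e: "e \<in> distance_graph m N f g" "e \<subseteq> \<Union>?M" for e
  proof -
    obtain i j' where ij: "e = {Inl i, Inr j'}" "m < card (sym_diff (f i) (g j'))"
      using e(1) unfolding distance_graph_def by blast
    have "Inl i \<in> \<Union>?M" "Inr j' \<in> \<Union>?M" using e(2) ij by auto
    then obtain j i' where P: "?P i j" "?P i' j'"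
      unfolding M by auto
    then have "i = i'" using cross ij(2) by blast
    then show ?thesis using P ij(1) unfolding M by blast
  qed
  ultimately show ?thesis
    unfolding induced_matching_def by blast
qed

lemma distance_graph_cover:
  fixes f g :: "nat \<Rightarrow> 'a set"
  assumes A: "finite A" "card A = 2 * m + 1"
    and inj: "inj_on f {..<N}" "inj_on g {..<N}"
    and sub: "\<And>i. i < N \<Longrightarrow> f i \<subseteq> A" "\<And>i. i < N \<Longrightarrow> g i \<subseteq> A"
  shows "\<exists>\<M>. finite \<M> \<and> card \<M> \<le> 6 * 12 ^ m \<and>
    (\<forall>M\<in>\<M>. induced_matching (distance_graph m N f g) M) \<and> distance_graph m N f g \<subseteq> \<Union>\<M>"
proof -
  let ?Z = "{z \<in> Pow A. m < card z}"
  have finZ: "finite z" if "z \<subseteq> A" for z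
    using A(1) that finite_subset by blast
  have "\<forall>z\<in>?Z. \<exists>c :: 'a set \<Rightarrow> nat. (\<forall>a\<in>Pow z. c a < 4 ^ card z div 3 ^ m) \<and>
    (\<forall>a\<in>Pow z. \<forall>b\<in>Pow z. a \<noteq> b \<longrightarrow> c a = c b \<longrightarrow> card z \<le> card (sym_diff a b) + m)"
    using finZ by (intro ballI code_partition) auto
  then obtain col :: "'a set \<Rightarrow> 'a set \<Rightarrow> nat" where col:
    "\<forall>z\<in>?Z. (\<forall>a\<in>Pow z. col z a < 4 ^ card z div 3 ^ m) \<and>
    (\<forall>a\<in>Pow z. \<forall>b\<in>Pow z. a \<noteq> b \<longrightarrow> col z a = col z b \<longrightarrow> card z \<le> card (sym_diff a b) + m)"
    by (rule bchoice[THEN exE])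
  define I where "I = (SIGMA z:?Z. Pow (A - z) \<times> {..<4 ^ card z div (3::nat) ^ m})"
  have finI: "finite I"
    unfolding I_def using A(1) by (intro finite_SigmaI) auto
  \<comment> \<open>The factor \<open>3 ^ m\<close> absorbs the rounded division; each element of
    \<open>A\<close> then contributes 4 + 2 = 6 to the total.\<close>
  have "card I * 3 ^ m = (\<Sum>z\<in>?Z. 2 ^ card (A - z) * (4 ^ card z div 3 ^ m * 3 ^ m))"
    unfolding I_def using A(1)
    by (subst card_SigmaI) (auto simp: card_cartesian_product card_Pow sum_distrib_right mult.assoc)
  also have "\<dots> \<le> (\<Sum>z\<in>?Z. 4 ^ card z * 2 ^ card (A - z))"
    by (intro sum_mono) (simp add: mult.commute)
  also have "\<dots> \<le> (\<Sum>z\<in>Pow A. 4 ^ card z * 2 ^ card (A - z))"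
    using A(1) by (intro sum_mono2) auto
  also have "\<dots> = 6 ^ (2 * m + 1)"
    using sum_Pow_power[OF A(1), of 4 2] A(2) by simp
  also have "\<dots> = 6 * 12 ^ m * (3::nat) ^ m"
    by (simp add: power_mult flip: power_mult_distrib)
  finally have cardI: "card I \<le> 6 * 12 ^ m"
    by simp
  let ?\<M> = "shift_class N f g col ` I"
  have "induced_matching (distance_graph m N f g) (shift_class N f g col (z, c, k))"
    if "(z, c, k) \<in> I" for z c k
    using that col by (intro induced_matching_shift_class inj finZ) (auto simp: I_def)
  moreover have "e \<in> \<Union>?\<M>" if e: "e \<in> distance_graph m N f g" for e
  proof -
    obtain i j where ij: "e = {Inl i, Inr j}" "i < N" "j < N" "m < card (sym_diff (f i) (g j))"
      using e unfolding distance_graph_def by blast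
    let ?z = "sym_diff (f i) (g j)"
    have "?z \<in> ?Z" using ij sub by blast
    then have "(?z, f i - ?z, col ?z (f i \<inter> ?z)) \<in> I"
      using col sub(1)[OF ij(2)] unfolding I_def by auto
    moreover have "e \<in> shift_class N f g col (?z, f i - ?z, col ?z (f i \<inter> ?z))"
      using ij unfolding shift_class_def by blast
    ultimately show ?thesis by blast
  qed
  moreover have "card ?\<M> \<le> 6 * 12 ^ m"
    using card_image_le[OF finI] cardI by (rule le_trans)
  ultimately show ?thesis
    using finI by (intro exI[of _ ?\<M>]) auto
qed

section \<open>The two complementary graphs\<close>

lemma card_sym_diff_complement:
  assumes "finite A" "a \<subseteq> A" "b \<subseteq> A"
  shows "card (sym_diff a (A - b)) = card A - card (sym_diff a b)"
proof -
  have "sym_diff a (A - b) = A - sym_diff a b"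
    using assms by blast
  then show ?thesis
    using assms by (simp add: card_Diff_subset finite_subset Un_least Diff_subset[THEN subset_trans])
qed

lemma bipartite_partition:
  assumes "N \<le> 2 ^ (2 * m + 1)"
  shows "\<exists>G :: nat \<Rightarrow> (nat + nat) set set.
    G 1 \<union> G 2 = complete_bipartite N \<and> G 1 \<inter> G 2 = {} \<and>
    (\<forall>i\<in>{1, 2}. \<exists>\<M>. finite \<M> \<and> card \<M> \<le> 6 * 12 ^ m \<and>
       (\<forall>M\<in>\<M>. induced_matching (G i) M) \<and> G i \<subseteq> \<Union>\<M>)"
proof -
  define A where "A = {..<2 * m + 1}"
  have A: "finite A" "card A = 2 * m + 1"
    by (simp_all add: A_def)
  have "card {..<N} \<le> card (Pow A)"
    using assms A by (simp add: card_Pow)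
  then obtain f where f: "inj_on f {..<N}" "f ` {..<N} \<subseteq> Pow A"
    using A(1) card_le_inj[of "{..<N}" "Pow A"] by auto
  define g where "g = (\<lambda>j. A - f j)"
  have sub: "f i \<subseteq> A" "g i \<subseteq> A" if "i < N" for i
    using f(2) that by (auto simp: g_def)
  have g: "inj_on g {..<N}"
  proof (rule inj_onI)
    fix i j assume ij: "i \<in> {..<N}" "j \<in> {..<N}" "g i = g j"
    then have "f i = f j"
      using sub(1)[of i] sub(1)[of j] unfolding g_def by blast
    then show "i = j" using f(1) ij by (auto dest: inj_onD)
  qed
  \<comment> \<open>The two distances add up to the odd number 2m + 1, so exactly one of them
    exceeds \<open>m\<close>.\<close>
  have flip: "m < card (sym_diff (f i) (g j)) \<longleftrightarrow> \<not> m < card (sym_diff (f i) (f j))"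
    if "i < N" "j < N" for i j
    unfolding g_def using card_sym_diff_complement[OF A(1) sub(1) sub(1)] that A(2) by auto
  let ?G = "\<lambda>i::nat. distance_graph m N f (if i = 1 then f else g)"
  have "?G 1 \<union> ?G 2 = complete_bipartite N"
    unfolding distance_graph_def complete_bipartite_def by (simp add: flip cong: conj_cong) blast
  moreover have "?G 1 \<inter> ?G 2 = {}"
    unfolding distance_graph_def using flip by (auto simp: edge_eq_iff)
  ultimately show ?thesis
    using A f(1) g
    by (intro exI[of _ ?G] conjI ballI distance_graph_cover)
      (auto split: if_splits dest: subsetD[OF sub(1)] subsetD[OF sub(2)])
qed

section \<open>From powers of 12 to the exponent in N\<close>

text \<open>Fifth powers reduce the case of exponent one to integers: 12^5 = 248832 and 4^9 =
  262144.\<close>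

lemma power_12_le: "(12::real) ^ m \<le> (4 ^ m) powr (9 / 5)"
proof -
  have eq: "(4 powr (9 / 5)) ^ Suc 4 = (4::real) ^ 9"
    by (simp only: powr_power) simp
  have "(12::real) ^ Suc 4 \<le> (4 powr (9 / 5)) ^ Suc 4"
    unfolding eq by simp
  then have "(12::real) \<le> 4 powr (9 / 5)"
    by (rule power_le_imp_le_base) simp
  then have "(12::real) ^ m \<le> (4 powr (9 / 5)) ^ m"
    by (rule power_mono) simp
  also have "\<dots> = (4 powr real m) powr (9 / 5)"
    by (simp add: powr_power powr_powr mult.commute)
  finally show ?thesis
    by (simp add: powr_realpow)
qed

text \<open>The least \<open>m\<close> giving enough labels works: for \<open>m = Suc k\<close>,
  minimality gives N > 2 * 4^k, hence 4^m < 2N.\<close>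

lemma obtain_scale:
  assumes "N > 0"
  obtains m where "N \<le> 2 ^ (2 * m + 1)" "(4::nat) ^ m \<le> 2 * N"
proof -
  define m where "m = (LEAST m. N \<le> 2 ^ (2 * m + 1))"
  have "N < 2 ^ N"
    by (rule less_exp)
  also have "\<dots> \<le> 2 ^ (2 * N + 1)"
    by (rule power_increasing) simp_all
  finally have "N \<le> 2 ^ (2 * N + 1)"
    by simp
  then have m: "N \<le> 2 ^ (2 * m + 1)"
    unfolding m_def by (rule LeastI)
  have "4 ^ m \<le> 2 * N"
  proof (cases m)
    case (Suc k)
    then have "\<not> N \<le> 2 ^ (2 * k + 1)"
      using not_less_Least[of k "\<lambda>m. N \<le> 2 ^ (2 * m + 1)"] m_def by simp
    then show ?thesis
      using Suc by (simp add: power_mult)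
  qed (use assms in simp)
  with m show ?thesis by (rule that)
qed

theorem theorem4p1:
  "\<exists>\<delta>::real. \<delta> > 0.058 \<and>
     (\<exists>C::real. \<forall>N::nat. \<exists>G :: nat \<Rightarrow> (nat + nat) set set.
        G 1 \<union> G 2 = complete_bipartite N \<and> G 1 \<inter> G 2 = {} \<and>
        (\<forall>i\<in>{1, 2}. \<exists>\<M>. finite \<M> \<and> real (card \<M>) \<le> C * real N powr (2 - \<delta>) \<and>
           (\<forall>M\<in>\<M>. induced_matching (G i) M) \<and> G i \<subseteq> \<Union>\<M>))"
proof (rule exI[of _ "1 / 5"], rule conjI, goal_cases)
  case 1
  show "(1 / 5 :: real) > 0.058"
    by simp
next
  case 2
  \<comment> \<open>The 6 comes from the count \<open>6 * 12 ^ m\<close>, the other factor from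
    bounding \<open>4 ^ m\<close> by \<open>2 * N\<close>.\<close>
  let ?C = "6 * 2 powr (9 / 5) :: real"
  have "\<exists>G :: nat \<Rightarrow> (nat + nat) set set.
        G 1 \<union> G 2 = complete_bipartite N \<and> G 1 \<inter> G 2 = {} \<and>
        (\<forall>i\<in>{1, 2}. \<exists>\<M>. finite \<M> \<and> real (card \<M>) \<le> ?C * real N powr (2 - 1 / 5) \<and>
           (\<forall>M\<in>\<M>. induced_matching (G i) M) \<and> G i \<subseteq> \<Union>\<M>)" for N :: nat
  proof (cases "N = 0")
    \<comment> \<open>Here the bound is 0, as \<open>0 powr (9 / 5) = 0\<close>, so the empty family
      of matchings is taken.\<close>
    case True
    then show ?thesis
      by (intro exI[of _ "\<lambda>_. {}"]) (auto simp: complete_bipartite_def intro!: exI[of _ "{}"])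
  next
    case False
    then obtain m where m: "N \<le> 2 ^ (2 * m + 1)" "(4::nat) ^ m \<le> 2 * N"
      using obtain_scale by blast
    have "(4::real) ^ m \<le> 2 * real N"
      using m(2) by (metis of_nat_le_iff of_nat_mult of_nat_numeral of_nat_power)
    then have "(12::real) ^ m \<le> (2 * real N) powr (9 / 5)"
      by (intro order.trans[OF power_12_le] powr_mono2) auto
    then have bound: "real k \<le> ?C * real N powr (2 - 1 / 5)" if "k \<le> 6 * 12 ^ m" for k :: nat
    proof -
      have "real k \<le> 6 * 12 ^ m"
        using that by (metis of_nat_le_iff of_nat_mult of_nat_numeral of_nat_power)
      with \<open>12 ^ m \<le> (2 * real N) powr (9 / 5)\<close> show ?thesis
        by (simp add: powr_mult)
    qed
    show ?thesis
      using bipartite_partition[OF m(1)] bound by meson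
  qed
  then show ?case
    by blast
qed

end
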